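(* Let $\mathcal{M}=(E,\mathcal{B})$ be a matroid of rank $k$ over a ground set $E$ of size $n$, and let $\kappa$ be the Ollivier--Ricci curvature of the basis exchange walk on $\mathcal{M}$. If $n>k+1$, then \[\kappa \geq -1 + \frac{2}{k} + \frac{3(k-1)}{k(n-k+1)}.\] If $n=k+1$, then $\kappa \geq 1/k$.
   Context: A matroid $\mathcal{M}=(E,\mathcal{B})$ is a finite set $E$ with a non-empty collection $\mathcal{B}$ of subsets (bases) such that no proper subset of a basis is a basis and the basis exchange property holds; its rank $k$ is the common size of its bases, and we assume $k\ge 1$ so that the walk below is defined. We write $B-u$ for $B\setminus\{u\}$ and $B+x$ for $B\cup\{x\}$. The basis exchange walk (down-up walk) on $\mathcal{M}$ is the Markov chain $P$ on $\mathcal{B}$ that from $S\in\mathcal{B}$ drops an element $u\in S$ chosen uniformly at random, then moves to a uniformly random basis containing $S-u$ (possibly $S$ itself). The metric on $\mathcal{B}$ is $d(S,T)=\inf\{t\ge 0: P^t(S,T)>0\}$. The Wasserstein distance is $\mathcal{W}(\mu,\nu)=\min \mathbb{E}\, d(X,Y)$, the minimum being over all couplings $(X,Y)$ of $X\sim\mu$ and $Y\sim\nu$. The Ollivier--Ricci curvature $\kappa$ of $P$ is the largest $\kappa$ such that $\mathcal{W}(P(S,\cdot),P(T,\cdot))\le(1-\kappa)\,d(S,T)$ for all $S,T\in\mathcal{B}$, i.e. $\kappa=\inf_{S\ne T}\left(1-\mathcal{W}(P(S,\cdot),P(T,\cdot))/d(S,T)\right)$ (with $\kappa=+\infty$ if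 there is only one basis). *)

theory Defs
  imports "HOL-Probability.Probability"
begin

locale matroid =
  fixes E :: "'a set" and \<B> :: "'a set set"
  assumes finite_ground: "finite E"
    and bases_subset: "B \<in> \<B> \<Longrightarrow> B \<subseteq> E"
    and bases_nonempty: "\<B> \<noteq> {}"
    and bases_minimal: "B \<in> \<B> \<Longrightarrow> A \<subset> B \<Longrightarrow> A \<notin> \<B>"
    and basis_exchange:
      "A \<in> \<B> \<Longrightarrow> B \<in> \<B> \<Longrightarrow> x \<in> A - B \<Longrightarrow> \<exists>y\<in>B - A. insert y (A - {x}) \<in> \<B>"

definition matroid_rank :: "'a set set \<Rightarrow> nat" where
  "matroid_rank \<B> = (THE k. \<forall>B\<in>\<B>. card B = k)"

primrec chain_pow :: "('s \<Rightarrow> 's pmf) \<Rightarrow> nat \<Rightarrow> 's \<Rightarrow> 's pmf" where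
  "chain_pow P 0 S = return_pmf S"
| "chain_pow P (Suc t) S = bind_pmf (P S) (chain_pow P t)"

text \<open>The infimum is taken over natural numbers, so this is the intended distance only if \<open>T\<close> can
  be reached from \<open>S\<close>. For the basis exchange walk this is always the case; see
  \<open>matroid.exchange_walk_reachable\<close> below.\<close>

definition chain_dist :: "('s \<Rightarrow> 's pmf) \<Rightarrow> 's \<Rightarrow> 's \<Rightarrow> nat" where
  "chain_dist P S T = Inf {t. pmf (chain_pow P t S) T > 0}"

definition couplings :: "'s pmf \<Rightarrow> 's pmf \<Rightarrow> ('s \<times> 's) pmf set" where
  "couplings \<mu> \<nu> = {\<pi>. map_pmf fst \<pi> = \<mu> \<and> map_pmf snd \<pi> = \<nu>}"

text \<open>Meant for finitely supported \<open>\<mu>\<close> and \<open>\<nu>\<close>: then every coupling is finitely supported, so all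
  the expectations exist.\<close>

definition wasserstein :: "('s \<Rightarrow> 's \<Rightarrow> nat) \<Rightarrow> 's pmf \<Rightarrow> 's pmf \<Rightarrow> real" where
  "wasserstein d \<mu> \<nu> =
     (INF \<pi>\<in>couplings \<mu> \<nu>. measure_pmf.expectation \<pi> (\<lambda>(x, y). real (d x y)))"

text \<open>The value is in \<open>ereal\<close> so that the infimum is \<open>\<infinity>\<close> if there is only one state.\<close>

definition ollivier_ricci :: "'s set \<Rightarrow> ('s \<Rightarrow> 's pmf) \<Rightarrow> ereal" where
  "ollivier_ricci \<Omega> P =
     (INF (S, T)\<in>{(S, T). S \<in> \<Omega> \<and> T \<in> \<Omega> \<and> S \<noteq> T}.
        ereal (1 - wasserstein (chain_dist P) (P S) (P T) / real (chain_dist P S T)))"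

definition exchange_walk :: "'a set set \<Rightarrow> 'a set \<Rightarrow> 'a set pmf" where
  "exchange_walk \<B> S =
     bind_pmf (pmf_of_set S) (\<lambda>u. pmf_of_set {B \<in> \<B>. S - {u} \<subseteq> B})"

context matroid
begin

lemma finite_basis: "B \<in> \<B> \<Longrightarrow> finite B"
  using bases_subset finite_ground finite_subset by blast

lemma finite_bases: "finite \<B>"
  by (rule finite_subset[of _ "Pow E"]) (use bases_subset finite_ground in auto)

lemma card_basis_le: "A \<in> \<B> \<Longrightarrow> B \<in> \<B> \<Longrightarrow> card A \<le> card B"
proof (induction "card (A - B)" arbitrary: A rule: less_induct)
  case less
  show ?case
  proof (cases "A \<subseteq> B")
    case True
    then show ?thesis using less.prems finite_basis card_mono by blast
  next
    case False
    then obtain x where x: "x \<in> A - B" by blast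
    then obtain y where y: "y \<in> B - A" "insert y (A - {x}) \<in> \<B>"
      using basis_exchange less.prems by blast
    let ?A = "insert y (A - {x})"
    have fA: "finite A" using less.prems finite_basis by blast
    have "?A - B = (A - B) - {x}" using x y by auto
    then have "card (?A - B) < card (A - B)"
      using x fA by (metis card_Diff1_less finite_Diff)
    then have "card ?A \<le> card B" using less.hyps less.prems y by blast
    moreover have "card ?A = card A"
      using x y fA card_Suc_Diff1[of A x] by simp
    ultimately show ?thesis by simp
  qed
qed

lemma card_basis: "B \<in> \<B> \<Longrightarrow> card B = matroid_rank \<B>"
proof -
  assume B: "B \<in> \<B>"
  have all: "\<forall>A\<in>\<B>. card A = card B" using B card_basis_le by (simp add: order_antisym)
  have "matroid_rank \<B> = card B"
    unfolding matroid_rank_def by (rule the_equality) (rule all, use B in simp)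
  then show ?thesis by simp
qed

lemma set_exchange_walk:
  assumes "S \<in> \<B>" "S \<noteq> {}"
  shows "set_pmf (exchange_walk \<B> S) = (\<Union>u\<in>S. {B \<in> \<B>. S - {u} \<subseteq> B})"
proof -
  have "set_pmf (pmf_of_set {B \<in> \<B>. S - {u} \<subseteq> B}) = {B \<in> \<B>. S - {u} \<subseteq> B}" for u
    by (rule set_pmf_of_set) (use assms finite_bases in auto)
  then show ?thesis
    unfolding exchange_walk_def set_bind_pmf
    by (simp only: set_pmf_of_set[OF assms(2) finite_basis[OF assms(1)]])
qed

lemma exchange_walk_reachable:
  assumes "S \<in> \<B>" "T \<in> \<B>"
  shows "\<exists>t. pmf (chain_pow (exchange_walk \<B>) t S) T > 0"
  using assms
proof (induction "card (S - T)" arbitrary: S rule: less_induct)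
  case less
  show ?case
  proof (cases "S \<subseteq> T")
    case True
    then have "S = T" using less.prems bases_minimal by blast
    then have "pmf (chain_pow (exchange_walk \<B>) 0 S) T > 0" by simp
    then show ?thesis by blast
  next
    case False
    then obtain x where x: "x \<in> S - T" by blast
    then obtain y where y: "y \<in> T - S" "insert y (S - {x}) \<in> \<B>"
      using basis_exchange less.prems by blast
    let ?S = "insert y (S - {x})"
    have "?S - T = (S - T) - {x}" using x y by auto
    then have "card (?S - T) < card (S - T)"
      using x finite_basis less.prems by (metis card_Diff1_less finite_Diff)
    then obtain t where "pmf (chain_pow (exchange_walk \<B>) t ?S) T > 0"
      using less.hyps less.prems y by blast
    then have t: "T \<in> set_pmf (chain_pow (exchange_walk \<B>) t ?S)"
      by (simp add: set_pmf_iff)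
    have "?S \<in> set_pmf (exchange_walk \<B> S)"
      using less.prems x y by (subst set_exchange_walk) auto
    then have "T \<in> set_pmf (chain_pow (exchange_walk \<B>) (Suc t) S)"
      using t by (auto simp: set_bind_pmf)
    then show ?thesis by (metis pmf_positive)
  qed
qed

lemma exchange_walk_dist_pos:
  assumes "S \<in> \<B>" "T \<in> \<B>" "S \<noteq> T"
  shows "chain_dist (exchange_walk \<B>) S T > 0"
proof (rule ccontr)
  let ?X = "{t. pmf (chain_pow (exchange_walk \<B>) t S) T > 0}"
  assume "\<not> ?thesis"
  moreover have "Inf ?X \<in> ?X"
    using exchange_walk_reachable[OF assms(1,2)] by (intro Inf_nat_def1) auto
  ultimately have "0 \<in> ?X" by (simp add: chain_dist_def)
  then show False using assms by simp
qed

end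

lemma chain_dist_self: "chain_dist P S S = 0"
proof -
  have "0 \<in> {t. pmf (chain_pow P t S) S > 0}" by simp
  then show ?thesis unfolding chain_dist_def by (metis cInf_lower bdd_below_bot le_zero_eq)
qed

lemma wasserstein_self:
  assumes "\<And>x. d x x = 0"
  shows "wasserstein d \<mu> \<mu> = 0"
proof (rule antisym)
  let ?\<pi> = "map_pmf (\<lambda>x. (x, x)) \<mu>"
  let ?f = "\<lambda>\<pi>. measure_pmf.expectation \<pi> (\<lambda>(x, y). real (d x y))"
  have c: "?\<pi> \<in> couplings \<mu> \<mu>" by (simp add: couplings_def map_pmf_comp)
  have nn: "?f \<pi> \<ge> 0" for \<pi> by (rule integral_nonneg_AE) auto
  have "wasserstein d \<mu> \<mu> \<le> ?f ?\<pi>"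
    unfolding wasserstein_def by (rule cINF_lower[OF _ c]) (use nn in \<open>auto intro!: bdd_belowI2\<close>)
  then show "wasserstein d \<mu> \<mu> \<le> 0" using assms by simp
  show "0 \<le> wasserstein d \<mu> \<mu>"
    unfolding wasserstein_def by (rule cINF_greatest) (use c nn in auto)
qed

text \<open>\<open>ollivier_ricci\<close> is the largest \<open>\<kappa>\<close> with \<open>W(P(S,\<cdot>), P(T,\<cdot>)) \<le> (1 - \<kappa>) d(S,T)\<close> for all bases
  \<open>S\<close> and \<open>T\<close>.\<close>

lemma (in matroid) le_ollivier_ricci_iff:
  "ereal c \<le> ollivier_ricci \<B> (exchange_walk \<B>) \<longleftrightarrow>
    (\<forall>S\<in>\<B>. \<forall>T\<in>\<B>. wasserstein (chain_dist (exchange_walk \<B>)) (exchange_walk \<B> S) (exchange_walk \<B> T)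
       \<le> (1 - c) * real (chain_dist (exchange_walk \<B>) S T))"
    (is "_ \<longleftrightarrow> (\<forall>S\<in>\<B>. \<forall>T\<in>\<B>. ?W S T \<le> (1 - c) * real (?d S T))")
proof -
  have eq: "c \<le> 1 - ?W S T / real (?d S T) \<longleftrightarrow> ?W S T \<le> (1 - c) * real (?d S T)"
    if "S \<in> \<B>" "T \<in> \<B>" "S \<noteq> T" for S T
    using exchange_walk_dist_pos[OF that] by (auto simp: field_simps)
  have diag: "?W S S \<le> (1 - c) * real (?d S S)" for S
    by (simp add: wasserstein_self chain_dist_self)
  have "ereal c \<le> ollivier_ricci \<B> (exchange_walk \<B>) \<longleftrightarrow>
      (\<forall>S\<in>\<B>. \<forall>T\<in>\<B>. S \<noteq> T \<longrightarrow> c \<le> 1 - ?W S T / real (?d S T))"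
    unfolding ollivier_ricci_def le_INF_iff by auto
  also have "\<dots> \<longleftrightarrow> (\<forall>S\<in>\<B>. \<forall>T\<in>\<B>. ?W S T \<le> (1 - c) * real (?d S T))"
    using eq diag by metis
  finally show ?thesis .
qed

end

theory Submission
  imports Defs
begin

text \<open>By path coupling it suffices to couple the walks from two bases \<open>S\<close> and \<open>T = S - a + b\<close>. Let both
  drop the same element, with \<open>b\<close> dropped from \<open>T\<close> when \<open>a\<close> is dropped from \<open>S\<close>. With probability \<open>1/k\<close>
  the element \<open>a\<close> is dropped and the walks meet. Suppose some \<open>u \<noteq> a\<close> is dropped. If \<open>S - u + b\<close> is not a
  basis, then exchanging \<open>a\<close> for \<open>b\<close> is a bijection between the completions of \<open>S - u\<close> and those of
  \<open>T - u\<close>, and the walks end at distance at most 1. Otherwise the two uniform distributions share the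
  basis \<open>S - u + b\<close>, and \<open>S\<close> can be coupled with \<open>T\<close>. Since each family of completions has at
  most \<open>n - k + 1\<close> members and all distances are at most 2, the expected distance is at most
  \<open>2 - 3 / (n - k + 1)\<close>.\<close>

section \<open>Upper bounds on transport cost\<close>

text \<open>A witnessing coupling in place of an infimum lets bounds be mixed and glued directly,
  and the nonnegative integral needs no integrability. Since \<open>ennreal\<close> truncates a
  negative \<open>c\<close> to 0, nonnegativity is assumed wherever bounds are added or read as
  reals.\<close>

definition transport_le :: "('s \<Rightarrow> 's \<Rightarrow> nat) \<Rightarrow> 's pmf \<Rightarrow> 's pmf \<Rightarrow> real \<Rightarrow> bool" where
  "transport_le d \<mu> \<nu> c \<longleftrightarrow>
     (\<exists>\<pi>\<in>couplings \<mu> \<nu>. (\<integral>\<^sup>+p. ennreal (real (d (fst p) (snd p))) \<partial>measure_pmf \<pi>) \<le> ennreal c)"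

lemma couplingsD:
  assumes "\<pi> \<in> couplings \<mu> \<nu>" "p \<in> set_pmf \<pi>"
  shows "fst p \<in> set_pmf \<mu>" "snd p \<in> set_pmf \<nu>"
  using assms unfolding couplings_def by auto

lemma transport_le_refl:
  assumes "\<And>x. x \<in> set_pmf \<mu> \<Longrightarrow> d x x = 0"
  shows "transport_le d \<mu> \<mu> 0"
  unfolding transport_le_def
proof (rule bexI)
  show "map_pmf (\<lambda>x. (x, x)) \<mu> \<in> couplings \<mu> \<mu>"
    by (simp add: couplings_def map_pmf_comp)
  show "(\<integral>\<^sup>+p. ennreal (real (d (fst p) (snd p))) \<partial>map_pmf (\<lambda>x. (x, x)) \<mu>) \<le> ennreal 0"
    using assms by (simp add: nn_integral_0_iff_AE AE_measure_pmf_iff)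
qed

lemma transport_le_weaken:
  assumes "transport_le d \<mu> \<nu> c" "c \<le> c'"
  shows "transport_le d \<mu> \<nu> c'"
  using assms unfolding transport_le_def by (meson ennreal_leI order_trans)

text \<open>The same coupling serves both costs. The comparison is asked on the supports only,
  because the distances below are compared on bases.\<close>

lemma transport_le_mono:
  assumes "transport_le d \<mu> \<nu> c"
    and "\<And>x y. x \<in> set_pmf \<mu> \<Longrightarrow> y \<in> set_pmf \<nu> \<Longrightarrow> d' x y \<le> d x y"
  shows "transport_le d' \<mu> \<nu> c"
proof -
  from assms(1) obtain \<pi> where \<pi>: "\<pi> \<in> couplings \<mu> \<nu>"
    "(\<integral>\<^sup>+p. ennreal (real (d (fst p) (snd p))) \<partial>\<pi>) \<le> ennreal c"
    unfolding transport_le_def by blast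
  have "(\<integral>\<^sup>+p. ennreal (real (d' (fst p) (snd p))) \<partial>\<pi>)
      \<le> (\<integral>\<^sup>+p. ennreal (real (d (fst p) (snd p))) \<partial>\<pi>)"
    by (intro nn_integral_mono_AE)
      (use assms(2) couplingsD[OF \<pi>(1)] in \<open>auto simp: AE_measure_pmf_iff\<close>)
  with \<pi> show ?thesis unfolding transport_le_def by (meson order_trans)
qed

lemma transport_le_swap:
  assumes "transport_le d \<mu> \<nu> c"
  shows "transport_le (\<lambda>x y. d y x) \<nu> \<mu> c"
proof -
  from assms obtain \<pi> where \<pi>: "\<pi> \<in> couplings \<mu> \<nu>"
    "(\<integral>\<^sup>+p. ennreal (real (d (fst p) (snd p))) \<partial>\<pi>) \<le> ennreal c"
    unfolding transport_le_def by blast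
  have "map_pmf prod.swap \<pi> \<in> couplings \<nu> \<mu>"
    using \<pi>(1) by (simp add: couplings_def map_pmf_comp)
  with \<pi>(2) show ?thesis
    unfolding transport_le_def by (intro bexI[of _ "map_pmf prod.swap \<pi>"]) auto
qed

lemma wasserstein_le:
  assumes "transport_le d \<mu> \<nu> c" "0 \<le> c"
  shows "wasserstein d \<mu> \<nu> \<le> c"
proof -
  let ?f = "\<lambda>\<pi>. measure_pmf.expectation \<pi> (\<lambda>(x, y). real (d x y))"
  from assms obtain \<pi> where \<pi>: "\<pi> \<in> couplings \<mu> \<nu>"
    "(\<integral>\<^sup>+p. ennreal (real (d (fst p) (snd p))) \<partial>\<pi>) \<le> ennreal c"
    unfolding transport_le_def by blast
  have nn: "?f \<pi>' \<ge> 0" for \<pi>' by (rule integral_nonneg_AE) auto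
  have "wasserstein d \<mu> \<nu> \<le> ?f \<pi>"
    unfolding wasserstein_def
    by (rule cINF_lower[OF _ \<pi>(1)]) (use nn in \<open>auto intro!: bdd_belowI2\<close>)
  \<comment> \<open>This needs no integrability: if the nonnegative integral is infinite, both sides
    are 0.\<close>
  also have "\<dots> = enn2real (\<integral>\<^sup>+p. ennreal (real (d (fst p) (snd p))) \<partial>\<pi>)"
    by (subst integral_eq_nn_integral) (auto simp: case_prod_beta)
  also have "\<dots> \<le> c" using \<pi>(2) assms(2) by (rule enn2real_leI[rotated])
  finally show ?thesis .
qed

text \<open>Draw one \<open>u\<close> for both sides, then use the coupling available for that
  \<open>u\<close>; the costs average.\<close>

lemma transport_le_bind_pmf_of_set:
  assumes A: "finite A" "A \<noteq> {}"
    and tr: "\<And>u. u \<in> A \<Longrightarrow> transport_le d (f u) (g u) (c u)"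
    and nn: "\<And>u. u \<in> A \<Longrightarrow> 0 \<le> c u"
  shows "transport_le d (bind_pmf (pmf_of_set A) f) (bind_pmf (pmf_of_set A) g)
           (sum c A / real (card A))"
proof -
  let ?I = "\<lambda>\<pi>. \<integral>\<^sup>+p. ennreal (real (d (fst p) (snd p))) \<partial>measure_pmf \<pi>"
  from tr obtain \<pi> where
    cp: "\<And>u. u \<in> A \<Longrightarrow> \<pi> u \<in> couplings (f u) (g u)" and
    le: "\<And>u. u \<in> A \<Longrightarrow> ?I (\<pi> u) \<le> ennreal (c u)"
    unfolding transport_le_def by metis
  have "bind_pmf (pmf_of_set A) \<pi>
      \<in> couplings (bind_pmf (pmf_of_set A) f) (bind_pmf (pmf_of_set A) g)"
    using cp A by (auto simp: couplings_def map_bind_pmf set_pmf_of_set[OF A(2,1)] intro!: bind_pmf_cong)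
  moreover have "?I (bind_pmf (pmf_of_set A) \<pi>) \<le> ennreal (sum c A / real (card A))"
  proof -
    have "?I (bind_pmf (pmf_of_set A) \<pi>) = (\<Sum>u\<in>A. ?I (\<pi> u)) / card A"
      using A by (simp add: nn_integral_pmf_of_set)
    also have "\<dots> \<le> (\<Sum>u\<in>A. ennreal (c u)) / card A"
      by (intro divide_right_mono_ennreal sum_mono le)
    also have "\<dots> = ennreal (sum c A / real (card A))"
      using A nn by (simp add: sum_ennreal divide_ennreal sum_nonneg card_gt_0_iff
          ennreal_of_nat_eq_real_of_nat)
    finally show ?thesis .
  qed
  ultimately show ?thesis unfolding transport_le_def by blast
qed

text \<open>The two couplings are glued along their common marginal: given its value, the remaining two
  coordinates are taken conditionally independent.\<close>

lemma transport_le_trans: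
  assumes "transport_le d \<mu> \<nu> c1" "transport_le d \<nu> \<rho> c2" "0 \<le> c1" "0 \<le> c2"
    and tri: "\<And>x y z. x \<in> set_pmf \<mu> \<Longrightarrow> y \<in> set_pmf \<nu> \<Longrightarrow> z \<in> set_pmf \<rho> \<Longrightarrow>
                d x z \<le> d x y + d y z"
  shows "transport_le d \<mu> \<rho> (c1 + c2)"
proof -
  let ?D = "\<lambda>p. ennreal (real (d (fst p) (snd p)))"
  from assms obtain \<pi>1 \<pi>2 where \<pi>1: "\<pi>1 \<in> couplings \<mu> \<nu>" "(\<integral>\<^sup>+p. ?D p \<partial>\<pi>1) \<le> ennreal c1"
    and \<pi>2: "\<pi>2 \<in> couplings \<nu> \<rho>" "(\<integral>\<^sup>+p. ?D p \<partial>\<pi>2) \<le> ennreal c2"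
    unfolding transport_le_def by blast
  have m1: "map_pmf snd \<pi>1 = \<nu>" and m2: "map_pmf fst \<pi>2 = \<nu>"
    using \<pi>1 \<pi>2 by (auto simp: couplings_def)
  define \<tau> where "\<tau> = bind_pmf \<nu> (\<lambda>y. pair_pmf (cond_pmf \<pi>1 {p. y = snd p}) (cond_pmf \<pi>2 {q. y = fst q}))"
  have ne1: "set_pmf \<pi>1 \<inter> {p. y = snd p} \<noteq> {}" if "y \<in> set_pmf \<nu>" for y
    using that unfolding m1[symmetric] by auto
  have ne2: "set_pmf \<pi>2 \<inter> {p. y = fst p} \<noteq> {}" if "y \<in> set_pmf \<nu>" for y
    using that unfolding m2[symmetric] by auto
  \<comment> \<open>Averaging the conditional laws of \<open>\<pi>1\<close> over the law
    \<open>\<nu>\<close> of its second coordinate restores \<open>\<pi>1\<close>; likewise below for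
    \<open>\<pi>2\<close> and its first coordinate.\<close>
  have "map_pmf fst \<tau> = bind_pmf \<nu> (\<lambda>y. cond_pmf \<pi>1 {p. y = snd p})"
    by (simp add: \<tau>_def map_bind_pmf map_fst_pair_pmf)
  also have "\<dots> = \<pi>1"
  proof (rule bind_cond_pmf_cancel)
    fix p assume "p \<in> set_pmf \<pi>1"
    then show "set_pmf \<nu> \<inter> {y. y = snd p} \<noteq> {}" unfolding m1[symmetric] by auto
  next
    fix y :: 'a and p :: "'a \<times> 'a" assume "y = snd p"
    then show "measure_pmf.prob \<pi>1 {p. y = snd p} = measure_pmf.prob \<nu> {y. y = snd p}"
      unfolding m1[symmetric] by (simp add: vimage_def eq_commute)
  qed (use ne1 in auto)
  finally have t1: "map_pmf fst \<tau> = \<pi>1" .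
  have "map_pmf snd \<tau> = bind_pmf \<nu> (\<lambda>y. cond_pmf \<pi>2 {p. y = fst p})"
    by (simp add: \<tau>_def map_bind_pmf map_snd_pair_pmf)
  also have "\<dots> = \<pi>2"
  proof (rule bind_cond_pmf_cancel)
    fix p assume "p \<in> set_pmf \<pi>2"
    then show "set_pmf \<nu> \<inter> {y. y = fst p} \<noteq> {}" unfolding m2[symmetric] by auto
  next
    fix y :: 'a and p :: "'a \<times> 'a" assume "y = fst p"
    then show "measure_pmf.prob \<pi>2 {p. y = fst p} = measure_pmf.prob \<nu> {y. y = fst p}"
      unfolding m2[symmetric] by (simp add: vimage_def eq_commute)
  qed (use ne2 in auto)
  finally have t2: "map_pmf snd \<tau> = \<pi>2" .
  let ?\<pi> = "map_pmf (\<lambda>(p, q). (fst p, snd q)) \<tau>"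
  have "map_pmf fst ?\<pi> = map_pmf fst (map_pmf fst \<tau>)"
    and "map_pmf snd ?\<pi> = map_pmf snd (map_pmf snd \<tau>)"
    by (simp_all add: map_pmf_comp case_prod_beta)
  then have cp: "?\<pi> \<in> couplings \<mu> \<rho>"
    using \<pi>1(1) \<pi>2(1) unfolding t1 t2 by (simp add: couplings_def)
  \<comment> \<open>The two pairs drawn by \<open>\<tau>\<close> share their middle value, and the
    triangle inequality passes through it.\<close>
  have tri': "d (fst p) (snd q) \<le> d (fst p) (snd p) + d (fst q) (snd q)"
    if "(p, q) \<in> set_pmf \<tau>" for p q
  proof -
    from that obtain y where y: "y \<in> set_pmf \<nu>" "p \<in> set_pmf \<pi>1" "q \<in> set_pmf \<pi>2"
      "snd p = y" "fst q = y"
      using ne1 ne2 by (auto simp: \<tau>_def set_cond_pmf)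
    then show ?thesis
      using tri[of "fst p" y "snd q"] couplingsD[OF \<pi>1(1)] couplingsD[OF \<pi>2(1)] by auto
  qed
  have "(\<integral>\<^sup>+p. ?D p \<partial>?\<pi>) = (\<integral>\<^sup>+r. ennreal (real (d (fst (fst r)) (snd (snd r)))) \<partial>\<tau>)"
    by (simp add: case_prod_beta)
  also have "\<dots> \<le> (\<integral>\<^sup>+r. ?D (fst r) + ?D (snd r) \<partial>\<tau>)"
  proof (intro nn_integral_mono_AE, unfold AE_measure_pmf_iff, intro ballI)
    fix r assume "r \<in> set_pmf \<tau>"
    then have "d (fst (fst r)) (snd (snd r)) \<le> d (fst (fst r)) (snd (fst r)) + d (fst (snd r)) (snd (snd r))"
      using tri'[of "fst r" "snd r"] by simp
    then show "ennreal (real (d (fst (fst r)) (snd (snd r)))) \<le> ?D (fst r) + ?D (snd r)"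
      by (simp flip: ennreal_plus of_nat_add)
  qed
  also have "\<dots> = (\<integral>\<^sup>+p. ?D p \<partial>map_pmf fst \<tau>) + (\<integral>\<^sup>+p. ?D p \<partial>map_pmf snd \<tau>)"
    by (simp add: nn_integral_add)
  also have "\<dots> \<le> ennreal c1 + ennreal c2"
    unfolding t1 t2 by (intro add_mono \<pi>1 \<pi>2)
  also have "\<dots> = ennreal (c1 + c2)" using assms by simp
  finally show ?thesis using cp unfolding transport_le_def by blast
qed

section \<open>Couplings of uniform distributions\<close>

text \<open>Draw \<open>y\<close> uniformly from \<open>Y\<close>, and take its preimage under
  \<open>j\<close> if there is one, a uniform element of \<open>X\<close> otherwise. Each
  \<open>x\<close> then has mass 1/|Y| + (1 - |X|/|Y|)/|X| = 1/|X|. Only the matched pairs are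
  credited with a saving against the constant cost \<open>D\<close>.\<close>

lemma transport_le_pmf_of_set_inj:
  assumes X: "finite X" "X \<noteq> {}" and Y: "finite Y"
    and j: "inj_on j X" "j ` X \<subseteq> Y"
    and D: "\<And>x y. x \<in> X \<Longrightarrow> y \<in> Y \<Longrightarrow> d x y \<le> D"
  shows "transport_le d (pmf_of_set X) (pmf_of_set Y)
           (real D - (\<Sum>x\<in>X. real D - real (d x (j x))) / real (card Y))"
proof -
  define i where "i = inv_into X j"
  define K where "K y = (if y \<in> j ` X then return_pmf (i y) else pmf_of_set X)" for y
  define \<pi> where "\<pi> = bind_pmf (pmf_of_set Y) (\<lambda>y. map_pmf (\<lambda>x. (x, y)) (K y))"
  have Y': "Y \<noteq> {}" using X j by auto
  have cY: "card Y > 0" and cX: "card X > 0" using X Y Y' by (auto simp: card_gt_0_iff)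
  have cYX: "card (Y - j ` X) = card Y - card X" "card X \<le> card Y"
    using j X Y card_inj_on_le by (auto simp: card_Diff_subset card_image)
  have split: "sum h Y = (\<Sum>x\<in>X. h (j x)) + sum h (Y - j ` X)" for h :: "'a \<Rightarrow> real"
  proof -
    have "sum h Y = sum h (j ` X) + sum h (Y - j ` X)"
      using sum.subset_diff[OF j(2) Y, of h] by simp
    then show ?thesis using j(1) by (simp add: sum.reindex)
  qed
  have ij: "i (j x) = x" if "x \<in> X" for x using that j by (simp add: i_def)
  have "bind_pmf (pmf_of_set Y) K = pmf_of_set X"
  proof (rule pmf_eqI)
    fix x
    have "pmf (bind_pmf (pmf_of_set Y) K) x = (\<Sum>y\<in>Y. pmf (K y) x) / card Y"
      using Y Y' by (rule pmf_bind_pmf_of_set[rotated])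
    also have "(\<Sum>y\<in>Y. pmf (K y) x) = (\<Sum>x'\<in>X. indicator {x} x') + (\<Sum>y\<in>Y - j ` X. pmf (pmf_of_set X) x)"
      unfolding split by (intro arg_cong2[of _ _ _ _ "(+)"] sum.cong)
        (auto simp: K_def ij indicator_def)
    also have "\<dots> = indicator X x + (real (card Y) - real (card X)) * (indicator X x / real (card X))"
      using X cYX by (simp add: indicator_def of_nat_diff if_distrib sum.If_cases)
    also have "\<dots> = real (card Y) * (indicator X x / real (card X))"
      using cX by (simp add: field_simps)
    finally show "pmf (bind_pmf (pmf_of_set Y) K) x = pmf (pmf_of_set X) x"
      using X cY by simp
  qed
  moreover have "map_pmf fst \<pi> = bind_pmf (pmf_of_set Y) K"
    by (simp add: \<pi>_def map_bind_pmf map_pmf_comp)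
  moreover have "map_pmf snd \<pi> = pmf_of_set Y"
    by (simp add: \<pi>_def map_bind_pmf map_pmf_comp bind_return_pmf')
  ultimately have cp: "\<pi> \<in> couplings (pmf_of_set X) (pmf_of_set Y)"
    by (simp add: couplings_def)
  \<comment> \<open>A bound on the conditional cost given \<open>y\<close>: exact at matched points,
    \<open>D\<close> elsewhere.\<close>
  define h where "h y = (if y \<in> j ` X then real (d (i y) y) else real D)" for y
  have hnn: "0 \<le> h y" for y by (simp add: h_def)
  have inner: "(\<integral>\<^sup>+x. ennreal (real (d x y)) \<partial>K y) \<le> ennreal (h y)" if "y \<in> Y" for y
  proof (cases "y \<in> j ` X")
    case True then show ?thesis by (simp add: K_def h_def)
  next
    case False
    have "(\<integral>\<^sup>+x. ennreal (real (d x y)) \<partial>pmf_of_set X) \<le> (\<integral>\<^sup>+x. ennreal (real D) \<partial>pmf_of_set X)"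
      using D that X by (intro nn_integral_mono_AE) (auto simp: AE_measure_pmf_iff)
    then show ?thesis using False by (simp add: K_def h_def)
  qed
  have "(\<integral>\<^sup>+p. ennreal (real (d (fst p) (snd p))) \<partial>\<pi>)
      = (\<Sum>y\<in>Y. \<integral>\<^sup>+x. ennreal (real (d x y)) \<partial>K y) / card Y"
    using Y Y' by (simp add: \<pi>_def nn_integral_pmf_of_set)
  also have "\<dots> \<le> (\<Sum>y\<in>Y. ennreal (h y)) / card Y"
    by (intro divide_right_mono_ennreal sum_mono inner)
  also have "\<dots> = ennreal (sum h Y / real (card Y))"
    using cY hnn by (simp add: sum_ennreal divide_ennreal sum_nonneg ennreal_of_nat_eq_real_of_nat)
  also have "sum h Y = (\<Sum>x\<in>X. real (d x (j x))) + (real (card Y) - real (card X)) * real D"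
  proof -
    have "(\<Sum>x\<in>X. h (j x)) = (\<Sum>x\<in>X. real (d x (j x)))"
      by (intro sum.cong) (auto simp: h_def ij)
    moreover have "sum h (Y - j ` X) = (\<Sum>y\<in>Y - j ` X. real D)"
      by (intro sum.cong) (auto simp: h_def)
    ultimately show ?thesis unfolding split using cYX by (simp add: of_nat_diff)
  qed
  also have "\<dots> / real (card Y) = real D - (\<Sum>x\<in>X. real D - real (d x (j x))) / real (card Y)"
    using cY by (simp add: field_simps sum_subtractf)
  finally show ?thesis using cp unfolding transport_le_def by blast
qed

text \<open>The cardinality hypothesis leaves room to extend the partial matching on
  \<open>Z\<close> to an injection of \<open>X\<close> into \<open>Y\<close>; the added pairs save a
  nonnegative amount because \<open>d\<close> is at most \<open>D\<close>.\<close>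

lemma transport_le_pmf_of_set:
  assumes X: "finite X" "X \<noteq> {}" and Y: "finite Y" and card: "card X \<le> card Y"
    and Z: "Z \<subseteq> X" and j: "inj_on j Z" "j ` Z \<subseteq> Y"
    and D: "\<And>x y. x \<in> X \<Longrightarrow> y \<in> Y \<Longrightarrow> d x y \<le> D"
  shows "transport_le d (pmf_of_set X) (pmf_of_set Y)
           (real D - (\<Sum>x\<in>Z. real D - real (d x (j x))) / real (card Y))"
proof -
  have fZ: "finite Z" using Z X finite_subset by blast
  have "card (X - Z) \<le> card (Y - j ` Z)"
    using X Y Z j card fZ by (simp add: card_Diff_subset card_image)
  then obtain h where h: "h ` (X - Z) \<subseteq> Y - j ` Z" "inj_on h (X - Z)"
    using card_le_inj[of "X - Z" "Y - j ` Z"] X Y by auto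
  define f where "f x = (if x \<in> Z then j x else h x)" for x
  have inj: "inj_on f X"
    using h j by (auto simp: inj_on_def f_def)
  have sub: "f ` X \<subseteq> Y" using h j by (auto simp: f_def)
  have "(\<Sum>x\<in>Z. real D - real (d x (j x))) = (\<Sum>x\<in>Z. real D - real (d x (f x)))"
    by (simp add: f_def)
  also have "\<dots> \<le> (\<Sum>x\<in>X. real D - real (d x (f x)))"
    by (intro sum_mono2 X Z) (use D sub in auto)
  finally have "real D - (\<Sum>x\<in>X. real D - real (d x (f x))) / real (card Y)
      \<le> real D - (\<Sum>x\<in>Z. real D - real (d x (j x))) / real (card Y)"
    by (simp add: divide_right_mono)
  with transport_le_pmf_of_set_inj[of X Y f d D] X Y inj sub D show ?thesis
    by (blast intro: transport_le_weaken)
qed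

section \<open>Completions after dropping an element\<close>

context matroid
begin

text \<open>The bases open to the up-step once \<open>u\<close> is dropped. For \<open>u\<close> in
  a basis \<open>S\<close> they correspond to the one-element bases of the contraction by
  \<open>S - {u}\<close>.\<close>

definition completions :: "'a set \<Rightarrow> 'a \<Rightarrow> 'a set set" where
  "completions S u = {B \<in> \<B>. S - {u} \<subseteq> B}"

text \<open>On bases this is symmetric, as all have the same size, and it bounds
  \<open>chain_dist\<close> from above, while its triangle inequality is elementary.\<close>

abbreviation (input) diff_dist :: "'a set \<Rightarrow> 'a set \<Rightarrow> nat" where
  "diff_dist A B \<equiv> card (A - B)"

lemma finite_completions: "finite (completions S u)"
  using finite_bases by (simp add: completions_def)

lemma self_in_completions: "S \<in> \<B> \<Longrightarrow> S \<in> completions S u"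
  by (auto simp: completions_def)

text \<open>Bases have equal size, so \<open>B\<close> exceeds \<open>S - {u}\<close> by a single
  element. The choice \<open>x = u\<close> is included and gives \<open>S\<close> back.\<close>

lemma completionsE:
  assumes "S \<in> \<B>" "u \<in> S" "B \<in> completions S u"
  obtains x where "x \<in> E" "x \<notin> S - {u}" "B = insert x (S - {u})"
proof -
  have B: "B \<in> \<B>" "S - {u} \<subseteq> B" using assms by (auto simp: completions_def)
  have "card (B - (S - {u})) = card B - card (S - {u})"
    using B finite_basis assms by (intro card_Diff_subset) auto
  also have "\<dots> = 1"
    using assms(1,2) B(1) card_basis finite_basis card_Suc_Diff1[of S u] by simp
  finally obtain x where "B - (S - {u}) = {x}" by (rule card_1_singletonE)
  then have "x \<in> E" "x \<notin> S - {u}" "B = insert x (S - {u})"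
    using B bases_subset by blast+
  then show ?thesis by (rule that)
qed

text \<open>A completion is determined by its added element, which is one of the n - k + 1 elements
  of \<open>E - (S - {u})\<close>. The additive form avoids truncated subtraction.\<close>

lemma card_completions_le:
  assumes "S \<in> \<B>" "u \<in> S"
  shows "card (completions S u) + matroid_rank \<B> \<le> card E + 1"
proof -
  have S: "S \<subseteq> E" "finite S" using assms bases_subset finite_basis by auto
  have "completions S u \<subseteq> (\<lambda>x. insert x (S - {u})) ` (E - (S - {u}))"
    using completionsE[OF assms] by blast
  then have "card (completions S u) \<le> card ((\<lambda>x. insert x (S - {u})) ` (E - (S - {u})))"
    using finite_ground by (intro card_mono) auto
  also have "\<dots> \<le> card (E - (S - {u}))"
    using finite_ground by (intro card_image_le) auto
  also have "\<dots> = card E - card (S - {u})"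
    using S by (intro card_Diff_subset) auto
  also have "card (S - {u}) = matroid_rank \<B> - 1"
    using assms card_basis S by simp
  finally have "card (completions S u) \<le> card E - (matroid_rank \<B> - 1)" .
  moreover have "matroid_rank \<B> \<le> card E" "matroid_rank \<B> > 0"
    using assms S card_basis[of S] card_mono[OF finite_ground S(1)] card_gt_0_iff[of S] by auto
  ultimately show ?thesis by linarith
qed

lemma card_basis_diff_commute:
  assumes "A \<in> \<B>" "B \<in> \<B>"
  shows "card (A - B) = card (B - A)"
  using assms card_basis finite_basis
  by (metis Int_commute card_Diff_subset_Int finite_Int)

text \<open>Apart from \<open>a\<close> and the added element \<open>x\<close>, everything in
  \<open>B\<close> lies in \<open>T - {u}\<close> and hence in \<open>B'\<close>.\<close>

lemma completions_dist_le_2: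
  assumes "S \<in> \<B>" "u \<in> S" "S - T = {a}" "B \<in> completions S u" "B' \<in> completions T u"
  shows "card (B - B') \<le> 2"
proof -
  obtain x where "B = insert x (S - {u})" using completionsE[OF assms(1,2,4)] by blast
  then have "B - B' \<subseteq> {a, x}" using assms(3,5) by (auto simp: completions_def)
  then have "card (B - B') \<le> card {a, x}" by (intro card_mono) auto
  also have "\<dots> \<le> 2" by (simp add: card_insert_if)
  finally show ?thesis .
qed

text \<open>The hypothesis \<open>insert b (S - {u}) \<notin> \<B>\<close> says that \<open>a\<close> and \<open>b\<close> are parallel in the
  contraction by \<open>S \<inter> T - {u}\<close>, so they are interchangeable in bases of this contraction.\<close>

lemma parallel_swap:
  assumes S: "S \<in> \<B>" and T: "T \<in> \<B>" and ab: "S - T = {a}" "T - S = {b}"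
    and u: "u \<in> S" "u \<in> T" and par: "insert b (S - {u}) \<notin> \<B>"
  shows "inj_on (\<lambda>B. insert b (B - {a})) (completions S u)"
    and "(\<lambda>B. insert b (B - {a})) ` completions S u \<subseteq> completions T u"
proof -
  \<comment> \<open>Since \<open>u \<in> T\<close>, \<open>u\<close> is not \<open>a\<close>, so
    \<open>a\<close> survives in \<open>S - {u}\<close>; and \<open>b\<close> could enter only as
    the added element, which would give the excluded set.\<close>
  have ab_mem: "a \<in> B" "b \<notin> B" if BX: "B \<in> completions S u" for B
  proof -
    obtain x where x: "B = insert x (S - {u})" using completionsE[OF S u(1) BX] by blast
    show "a \<in> B" using BX ab u by (auto simp: completions_def)
    have "B \<in> \<B>" using BX by (simp add: completions_def)
    then show "b \<notin> B" using x ab par by auto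
  qed
  show "inj_on (\<lambda>B. insert b (B - {a})) (completions S u)"
  proof (rule inj_on_inverseI)
    fix B assume "B \<in> completions S u"
    then show "insert a (insert b (B - {a}) - {b}) = B" using ab_mem[of B] by auto
  qed
  show "(\<lambda>B. insert b (B - {a})) ` completions S u \<subseteq> completions T u"
  proof (rule image_subsetI)
    fix B assume BX: "B \<in> completions S u"
    then have B: "B \<in> \<B>" "S - {u} \<subseteq> B" by (auto simp: completions_def)
    obtain x where x: "x \<notin> S - {u}" "B = insert x (S - {u})"
      using completionsE[OF S u(1) BX] by blast
    have "insert b (B - {a}) \<in> \<B>"
    proof (cases "u \<in> B")
      case True
      then have "S = B" using B S bases_minimal[of B S] by blast
      then have "insert b (B - {a}) = T" using ab by auto
      then show ?thesis using T by simp
    next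
      case False
      \<comment> \<open>Exchange \<open>u\<close> out of \<open>T\<close>. Outside \<open>T\<close>
        the basis \<open>B\<close> has at most the elements \<open>a\<close> and \<open>x\<close>;
        taking \<open>a\<close> would produce the excluded set \<open>insert b (S - {u})\<close>, so
        \<open>x\<close> comes in.\<close>
      then obtain y where y: "y \<in> B - T" "insert y (T - {u}) \<in> \<B>"
        using basis_exchange[OF T B(1)] u by blast
      have "insert a (T - {u}) = insert b (S - {u})" using ab u by auto
      then have "y \<noteq> a" using y par by auto
      then have "y = x" using y x ab by auto
      moreover have "insert x (T - {u}) = insert b (B - {a})"
        using x ab u \<open>y \<noteq> a\<close> \<open>y = x\<close> by auto
      ultimately show ?thesis using y by simp
    qed
    then show "insert b (B - {a}) \<in> completions T u"
      using B ab by (auto simp: completions_def)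
  qed
qed

text \<open>Swapping \<open>a\<close> for \<open>b\<close> matches the two families completely, and
  each pair saves at least 1 against the bound 2.\<close>

lemma transport_completions_parallel:
  assumes S: "S \<in> \<B>" and T: "T \<in> \<B>" and ab: "S - T = {a}" "T - S = {b}"
    and u: "u \<in> S" "u \<in> T" and par: "insert b (S - {u}) \<notin> \<B>"
  shows "transport_le diff_dist (pmf_of_set (completions S u)) (pmf_of_set (completions T u)) 1"
proof -
  let ?X = "completions S u" and ?Y = "completions T u" and ?j = "\<lambda>B. insert b (B - {a})"
  \<comment> \<open>The excluded set is unchanged when \<open>S\<close> and \<open>T\<close> trade
    roles, so there is an injection back and the families have equal size.\<close>
  have "insert a (T - {u}) = insert b (S - {u})" using ab u by auto
  with par have par': "insert a (T - {u}) \<notin> \<B>" by simp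
  note j = parallel_swap[OF assms]
  note j' = parallel_swap[OF T S ab(2,1) u(2,1) par']
  have eq: "card ?X = card ?Y"
    by (intro antisym card_inj_on_le[OF j] card_inj_on_le[OF j'] finite_completions)
  have ne: "?X \<noteq> {}" using self_in_completions[OF S] by blast
  have pos: "card ?X > 0" using ne finite_completions by (simp add: card_gt_0_iff)
  have "transport_le diff_dist (pmf_of_set ?X) (pmf_of_set ?Y)
      (real 2 - (\<Sum>B\<in>?X. real 2 - real (card (B - ?j B))) / real (card ?Y))"
    by (intro transport_le_pmf_of_set finite_completions ne j)
      (use eq completions_dist_le_2[OF S u(1) ab(1)] in auto)
  moreover have "real (card ?X) \<le> (\<Sum>B\<in>?X. real 2 - real (card (B - ?j B)))"
  proof -
    have "(\<Sum>B\<in>?X. 1) \<le> (\<Sum>B\<in>?X. real 2 - real (card (B - ?j B)))"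
    proof (rule sum_mono)
      fix B
      have "card (B - ?j B) \<le> card {a}" by (intro card_mono) auto
      then show "1 \<le> real 2 - real (card (B - ?j B))" by simp
    qed
    then show ?thesis by simp
  qed
  ultimately show ?thesis
    using eq pos by (elim transport_le_weaken) (simp add: field_simps)
qed

text \<open>Two pairs are matched: the common basis with itself, and \<open>S\<close> with \<open>T\<close>. Against the trivial
  distance \<open>2\<close> they save \<open>2\<close> and \<open>1\<close>.\<close>

lemma transport_completions_nonparallel:
  assumes S: "S \<in> \<B>" and T: "T \<in> \<B>" and ab: "S - T = {a}" "T - S = {b}"
    and u: "u \<in> S" "u \<in> T" and W: "insert b (S - {u}) \<in> \<B>"
    and card: "card (completions S u) \<le> card (completions T u)"
  shows "transport_le diff_dist (pmf_of_set (completions S u)) (pmf_of_set (completions T u))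
           (2 - 3 / real (card (completions T u)))"
proof -
  let ?X = "completions S u" and ?Y = "completions T u" and ?W = "insert b (S - {u})"
  let ?j = "\<lambda>B. if B = S then T else B"
  have ne: "?W \<noteq> S" "?W \<noteq> T" using ab u by blast+
  have ZX: "{?W, S} \<subseteq> ?X" using S W by (auto simp: completions_def)
  have jY: "?j ` {?W, S} \<subseteq> ?Y" using T W ne ab by (auto simp: completions_def)
  have inj: "inj_on ?j {?W, S}" using ne by (auto simp: inj_on_def)
  have "transport_le diff_dist (pmf_of_set ?X) (pmf_of_set ?Y)
      (real 2 - (\<Sum>B\<in>{?W, S}. real 2 - real (card (B - ?j B))) / real (card ?Y))"
    by (rule transport_le_pmf_of_set)
      (use finite_completions card ZX jY inj completions_dist_le_2[OF S u(1) ab(1)] in auto)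
  moreover have "(\<Sum>B\<in>{?W, S}. real 2 - real (card (B - ?j B))) = 3"
    using ne ab by simp
  ultimately show ?thesis by simp
qed

text \<open>The distance is symmetric on bases; this permits choosing which family of completions
  comes first.\<close>

lemma transport_le_diff_dist_commute:
  assumes "transport_le diff_dist \<mu> \<nu> c" "set_pmf \<mu> \<subseteq> \<B>" "set_pmf \<nu> \<subseteq> \<B>"
  shows "transport_le diff_dist \<nu> \<mu> c"
proof (rule transport_le_mono[OF transport_le_swap[OF assms(1)]])
  fix x y assume "x \<in> set_pmf \<nu>" "y \<in> set_pmf \<mu>"
  then show "card (x - y) \<le> card (y - x)"
    using assms(2,3) by (metis card_basis_diff_commute order_refl subsetD)
qed

text \<open>The maximum covers both cases: 1 if \<open>a\<close> and \<open>b\<close> are parallel,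
  and otherwise the second entry, as a family has at most n - k + 1 members.\<close>

lemma transport_completions:
  assumes "S \<in> \<B>" "T \<in> \<B>" "S - T = {a}" "T - S = {b}" "u \<in> S" "u \<in> T"
  shows "transport_le diff_dist (pmf_of_set (completions S u)) (pmf_of_set (completions T u))
           (max 1 (2 - 3 / (real (card E) - real (matroid_rank \<B>) + 1)))"
    (is "transport_le _ _ _ ?M")
  using assms
\<comment> \<open>The matching is an injection of the smaller family into the larger, so the sizes
  are ordered first; symmetry gives the other order.\<close>
proof (induction "card (completions S u)" "card (completions T u)" arbitrary: S T a b
    rule: linorder_wlog)
  case (le S T a b)
  show ?case
  proof (cases "insert b (S - {u}) \<in> \<B>")
    case False
    then show ?thesis
      using transport_completions_parallel[OF le.prems] by (rule_tac transport_le_weaken) auto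
  next
    case True
    have "card (completions T u) > 0"
      using self_in_completions[of T u] le.prems finite_completions by (auto simp: card_gt_0_iff)
    moreover have "real (card (completions T u)) \<le> real (card E) - real (matroid_rank \<B>) + 1"
      using card_completions_le[of T u] le.prems by linarith
    ultimately have "2 - 3 / real (card (completions T u)) \<le> ?M"
      by (simp add: frac_le max.coboundedI2)
    then show ?thesis
      using transport_completions_nonparallel[OF le.prems True le.hyps]
      by (rule_tac transport_le_weaken)
  qed
next
  case (sym S T a b)
  have "set_pmf (pmf_of_set (completions S u)) \<subseteq> \<B>" if "S \<in> \<B>" for S
    using that self_in_completions[of S u] finite_completions
    by (subst set_pmf_of_set) (auto simp: completions_def)
  then show ?case using sym by (blast intro: transport_le_diff_dist_commute)
qed

section \<open>One step from adjacent bases\<close>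

lemma exchange_walk_completions:
  "exchange_walk \<B> S = bind_pmf (pmf_of_set S) (\<lambda>u. pmf_of_set (completions S u))"
  by (simp add: exchange_walk_def completions_def)

text \<open>Dropping \<open>a\<close> and \<open>b\<close> together leaves the same set, at cost 0;
  each of the other k - 1 drops costs at most the bound for completions.\<close>

lemma transport_exchange_walk_adjacent:
  assumes S: "S \<in> \<B>" and T: "T \<in> \<B>" and ab: "S - T = {a}" "T - S = {b}"
  defines "k \<equiv> matroid_rank \<B>"
  shows "transport_le diff_dist (exchange_walk \<B> S) (exchange_walk \<B> T)
           ((real k - 1) / real k * max 1 (2 - 3 / (real (card E) - real k + 1)))"
    (is "transport_le _ _ _ (_ * ?M)")
proof -
  \<comment> \<open>Pairs the element dropped from \<open>S\<close> with the one dropped from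
    \<open>T\<close>; being a bijection, it keeps the latter uniform.\<close>
  define \<sigma> where "\<sigma> u = (if u = a then b else u)" for u
  have fS: "finite S" "S \<noteq> {}" using S finite_basis ab by auto
  have ST: "T = insert b (S - {a})" "a \<in> S" "b \<notin> S" using ab by auto
  have "bij_betw \<sigma> S T"
    unfolding bij_betw_def using ST by (auto simp: inj_on_def \<sigma>_def image_def)
  then have "pmf_of_set T = map_pmf \<sigma> (pmf_of_set S)"
    using map_pmf_of_set_bij_betw fS by metis
  then have PT: "exchange_walk \<B> T
      = bind_pmf (pmf_of_set S) (\<lambda>u. pmf_of_set (completions T (\<sigma> u)))"
    by (simp add: exchange_walk_completions bind_map_pmf)
  define c where "c u = (if u = a then 0 else ?M)" for u
  have "transport_le diff_dist (exchange_walk \<B> S) (exchange_walk \<B> T) (sum c S / real (card S))"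
    unfolding exchange_walk_completions[of S] PT
  proof (rule transport_le_bind_pmf_of_set[OF fS])
    fix u assume u: "u \<in> S"
    show "transport_le diff_dist (pmf_of_set (completions S u)) (pmf_of_set (completions T (\<sigma> u))) (c u)"
    proof (cases "u = a")
      case True
      have "completions T b = completions S a" using ST by (auto simp: completions_def)
      then show ?thesis using True by (simp add: \<sigma>_def c_def transport_le_refl)
    next
      case False
      then have "u \<in> T" using ST u by auto
      from transport_completions[OF S T ab u this] False show ?thesis
        by (simp add: \<sigma>_def c_def k_def)
    qed
    show "0 \<le> c u" by (simp add: c_def max.coboundedI1)
  qed
  moreover have "sum c S / real (card S) = (real k - 1) / real k * ?M"
  proof -
    have "sum c S = c a + sum c (S - {a})" using fS ST by (intro sum.remove) auto
    also have "sum c (S - {a}) = (\<Sum>u\<in>S - {a}. ?M)" by (intro sum.cong) (auto simp: c_def)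
    also have "\<dots> = (real k - 1) * ?M"
      using fS ST card_basis[OF S] card_gt_0_iff[of S] by (simp add: k_def of_nat_diff)
    finally show ?thesis using card_basis[OF S] by (simp add: c_def k_def)
  qed
  ultimately show ?thesis by simp
qed

section \<open>Path coupling\<close>

lemma set_exchange_walk_subset:
  assumes "S \<in> \<B>" "S \<noteq> {}"
  shows "set_pmf (exchange_walk \<B> S) \<subseteq> \<B>"
  using set_exchange_walk[OF assms] by auto

text \<open>Every move other than staying put is a single exchange, so the bound for adjacent bases
  applies along trajectories.\<close>

lemma exchange_walk_step:
  assumes S: "S \<in> \<B>" "S \<noteq> {}" and S': "S' \<in> set_pmf (exchange_walk \<B> S)" "S' \<noteq> S"
  obtains a b where "S - S' = {a}" "S' - S = {b}"
proof -
  from S' obtain u where u: "u \<in> S" "S' \<in> completions S u"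
    using set_exchange_walk[OF S] by (auto simp: completions_def)
  then obtain x where x: "x \<notin> S - {u}" "S' = insert x (S - {u})"
    using completionsE[OF S(1)] by metis
  with u S' have "S - S' = {u}" "S' - S = {x}" by auto
  then show ?thesis by (rule that)
qed

text \<open>Exchanging the elements of \<open>S - T\<close> one at a time is a trajectory of
  positive probability.\<close>

lemma chain_dist_exchange_walk_le:
  assumes "S \<in> \<B>" "T \<in> \<B>"
  shows "chain_dist (exchange_walk \<B>) S T \<le> card (S - T)"
proof -
  have "T \<in> set_pmf (chain_pow (exchange_walk \<B>) (card (S - T)) S)"
    using assms
  proof (induction "card (S - T)" arbitrary: S)
    case 0
    then have "S \<subseteq> T" using finite_basis by auto
    then have "S = T" using 0 bases_minimal by blast
    then show ?case by simp
  next
    case (Suc m)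
    then obtain x where x: "x \<in> S - T" by (metis card.empty ex_in_conv nat.distinct(1))
    then obtain y where y: "y \<in> T - S" "insert y (S - {x}) \<in> \<B>"
      using basis_exchange Suc.prems by blast
    let ?S = "insert y (S - {x})"
    have "?S - T = (S - T) - {x}" using x y by auto
    then have m: "m = card (?S - T)" using x Suc.hyps(2) by simp
    then have "T \<in> set_pmf (chain_pow (exchange_walk \<B>) m ?S)"
      using Suc.hyps(1)[OF m] y Suc.prems by simp
    moreover have "?S \<in> set_pmf (exchange_walk \<B> S)"
      using Suc.prems x y by (subst set_exchange_walk) auto
    ultimately show ?case unfolding Suc.hyps(2)[symmetric] by (auto simp: set_bind_pmf)
  qed
  then have "pmf (chain_pow (exchange_walk \<B>) (card (S - T)) S) T > 0"
    by (simp add: pmf_positive)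
  then show ?thesis unfolding chain_dist_def by (intro wellorder_Inf_le1) simp
qed

text \<open>Gluing along a trajectory from \<open>S\<close> to \<open>T\<close> adds one
  \<open>C\<close> per step; a step that stays put costs 0, which \<open>0 \<le> C\<close>
  covers.\<close>

lemma transport_exchange_walk_path:
  assumes step: "\<And>S T a b. S \<in> \<B> \<Longrightarrow> T \<in> \<B> \<Longrightarrow> S - T = {a} \<Longrightarrow> T - S = {b} \<Longrightarrow>
      transport_le diff_dist (exchange_walk \<B> S) (exchange_walk \<B> T) C"
    and C: "0 \<le> C" and rank: "matroid_rank \<B> \<ge> 1"
    and "S \<in> \<B>" "T \<in> set_pmf (chain_pow (exchange_walk \<B>) t S)"
  shows "transport_le diff_dist (exchange_walk \<B> S) (exchange_walk \<B> T) (real t * C) \<and> T \<in> \<B>"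
  using assms(4,5)
proof (induction t arbitrary: S)
  case 0
  then show ?case by (simp add: transport_le_refl)
next
  case (Suc t)
  have ne: "S \<noteq> {}" if "S \<in> \<B>" for S using card_basis[OF that] rank by auto
  from Suc.prems obtain S' where S': "S' \<in> set_pmf (exchange_walk \<B> S)"
    "T \<in> set_pmf (chain_pow (exchange_walk \<B>) t S')" by (auto simp: set_bind_pmf)
  have B: "S' \<in> \<B>" using S' set_exchange_walk_subset[OF Suc.prems(1) ne] Suc.prems(1) by auto
  note IH = Suc.IH[OF B S'(2)]
  have 1: "transport_le diff_dist (exchange_walk \<B> S) (exchange_walk \<B> S') C"
  proof (cases "S' = S")
    case True
    have "transport_le diff_dist (exchange_walk \<B> S) (exchange_walk \<B> S) 0"
      by (rule transport_le_refl) simp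
    then show ?thesis using True C transport_le_weaken by blast
  next
    case False
    then show ?thesis
      using exchange_walk_step[OF Suc.prems(1) ne S'(1)] step Suc.prems(1) B by metis
  qed
  have "transport_le diff_dist (exchange_walk \<B> S) (exchange_walk \<B> T) (C + real t * C)"
  proof (rule transport_le_trans[OF 1])
    show "card (x - z) \<le> card (x - y) + card (y - z)"
      if "x \<in> set_pmf (exchange_walk \<B> S)" "y \<in> set_pmf (exchange_walk \<B> S')" for x y z
    proof -
      have "finite x" "finite y"
        using that set_exchange_walk_subset ne Suc.prems(1) B finite_basis by blast+
      then have "card (x - z) \<le> card ((x - y) \<union> (y - z))" by (intro card_mono) auto
      also have "\<dots> \<le> card (x - y) + card (y - z)" by (rule card_Un_le)
      finally show ?thesis .
    qed
  qed (use IH C in auto)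
  then show ?case using IH by (simp add: algebra_simps)
qed

text \<open>Path length is measured by \<open>chain_dist\<close> and transport cost by
  \<open>diff_dist\<close>. The latter dominates the former on bases, so the cost bound passes to
  \<open>chain_dist\<close>.\<close>

lemma wasserstein_exchange_walk_le:
  assumes S: "S \<in> \<B>" and T: "T \<in> \<B>" and rank: "matroid_rank \<B> \<ge> 1"
  defines "k \<equiv> matroid_rank \<B>"
  shows "wasserstein (chain_dist (exchange_walk \<B>)) (exchange_walk \<B> S) (exchange_walk \<B> T)
    \<le> (real k - 1) / real k * max 1 (2 - 3 / (real (card E) - real k + 1))
      * real (chain_dist (exchange_walk \<B>) S T)"
    (is "_ \<le> ?C * real ?t")
proof -
  have C: "0 \<le> ?C" using rank by (simp add: k_def)
  \<comment> \<open>The infimum of a nonempty set of naturals is attained, so some trajectory has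
    exactly this length.\<close>
  have "?t \<in> {t. pmf (chain_pow (exchange_walk \<B>) t S) T > 0}"
    unfolding chain_dist_def using exchange_walk_reachable[OF S T] by (intro Inf_nat_def1) auto
  then have "T \<in> set_pmf (chain_pow (exchange_walk \<B>) ?t S)" by (simp add: set_pmf_iff)
  from transport_exchange_walk_path[OF _ C rank S this]
  have "transport_le diff_dist (exchange_walk \<B> S) (exchange_walk \<B> T) (real ?t * ?C)"
    using transport_exchange_walk_adjacent unfolding k_def by blast
  then have "transport_le (chain_dist (exchange_walk \<B>)) (exchange_walk \<B> S) (exchange_walk \<B> T)
      (real ?t * ?C)"
  proof (rule transport_le_mono)
    fix x y assume "x \<in> set_pmf (exchange_walk \<B> S)" "y \<in> set_pmf (exchange_walk \<B> T)"
    moreover have "S \<noteq> {}" "T \<noteq> {}" using card_basis[OF S] card_basis[OF T] rank by auto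
    ultimately show "chain_dist (exchange_walk \<B>) x y \<le> card (x - y)"
      using set_exchange_walk_subset S T by (intro chain_dist_exchange_walk_le) blast+
  qed
  then have "wasserstein (chain_dist (exchange_walk \<B>)) (exchange_walk \<B> S) (exchange_walk \<B> T)
      \<le> real ?t * ?C"
    by (rule wasserstein_le) (intro mult_nonneg_nonneg of_nat_0_le_iff C)
  then show ?thesis by (subst mult.commute)
qed

end

section \<open>The curvature bound\<close>

theorem theorem3p1:
  fixes E :: "'a set" and \<B> :: "'a set set" and n k :: nat and \<kappa> :: ereal
  assumes "matroid E \<B>"
    and "matroid_rank \<B> = k" and "k \<ge> 1"
    and "card E = n"
    and "\<kappa> = ollivier_ricci \<B> (exchange_walk \<B>)"
  shows "(n > k + 1 \<longrightarrow>
            \<kappa> \<ge> ereal (-1 + 2 / real k + 3 * (real k - 1) / (real k * (real n - real k + 1)))) \<and>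
         (n = k + 1 \<longrightarrow> \<kappa> \<ge> ereal (1 / real k))"
proof -
  interpret matroid E \<B> by fact
  let ?C = "(real k - 1) / real k * max 1 (2 - 3 / (real n - real k + 1))"
  have "ereal (1 - ?C) \<le> \<kappa>"
    unfolding assms(5) le_ollivier_ricci_iff
    using wasserstein_exchange_walk_le assms by simp
  moreover have "1 - ?C = -1 + 2 / real k + 3 * (real k - 1) / (real k * (real n - real k + 1))"
    if "n > k + 1"
  proof -
    define m where "m = real n - real k + 1"
    \<comment> \<open>For positive \<open>m\<close>, the value 3 is the threshold from which 2 - 3/m
      is at least 1.\<close>
    have m: "m \<ge> 3" using that by (simp add: m_def)
    then have "max 1 (2 - 3 / m) = 2 - 3 / m" by (simp add: field_simps)
    then show ?thesis
      using m \<open>k \<ge> 1\<close> unfolding m_def[symmetric] by (simp add: field_simps)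
  qed
  \<comment> \<open>Here n - k + 1 = 2 and 2 - 3/2 is below 1, so the maximum is 1 and
    \<open>?C\<close> equals 1 - 1/k.\<close>
  moreover have "1 - ?C = 1 / real k" if "n = k + 1"
    using that \<open>k \<ge> 1\<close> by (simp add: field_simps)
  ultimately show ?thesis by metis
qed

end
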